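(* Under the standing assumptions (1)–(6) of the context, suppose that $\mu$ has the following decorrelation property: for all functions $f,g$ on $\Omega$ with bounded support, $$\lim_{|x|\to\infty}\mathrm{Cov}_\mu(f,\tau_xg)=0 .$$ Then, for any local function $f$, $$\lim_{|x|\to\infty}\mu_\varepsilon(\tau_xf)=\mu(f).$$
   Context: $S$ is a compact Polish space, $\Omega=S^{\mathbb Z^d}$ with the product topology, $(\tau_x\eta)(y)=\eta(x+y)$, and $\tau_xf:=f\circ\tau_x$. A function on $\Omega$ has bounded support, or is local, if it is bounded, measurable and depends only on the coordinates in a finite subset of $\mathbb Z^d$. $C(\Omega)$ is the space of real continuous functions with sup norm. For a measure $\nu$, $\nu(f)=\int f\,d\nu$. $\|\cdot\|$ is the norm of $L^2(\mu)$ and the associated operator norm. Standing assumptions. (1) The dynamic random environment $(\sigma_t)_{t\ge0}$ is a Feller Markov process on $\Omega$ with càdlàg paths, stationary w.r.t. a probability measure $\mu$ which is translation invariant. $S_{\rm env}(t)$ is its semigroup on $L^2(\mu)$, with generator $L_{\rm env}$ of domain $\mathcal D(L_{\rm env})$; its generator on $C(\Omega)$ is $\mathcal L_{\rm env}$, with domain $\mathcal D(\mathcal L_{\rm env})$. (2) $S_{\rm env}(t)(f\circ\tau_x)=(S_{\rm env}(t)f)\circ\tau_x$ for all $f\in L^2(\mu)$, $t\ge0$, $x\in\mathbb Z^d$; and for some $\gamma>0$ the Poincaré inequality $\gamma\|f\|^2\le-\mu(fL_{\rm env}f)$ holds for all $f\in\mathcal D(L_{\rm env})$ with $\mu(f)=0$.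 (3) There are continuous functions $r_\varepsilon(y,\cdot),r(y,\cdot),\hat r_\varepsilon(y,\cdot)$ on $\Omega$, $y\in\mathbb Z^d$, which vanish for $y=0$, with $r_\varepsilon,r\ge0$ and $r_\varepsilon=r+\hat r_\varepsilon$, such that for some $n\ge1$: $\sum_y|y|^n\sup_\eta r(y,\eta)<\infty$ and $\sum_y|y|^n\sup_\eta|\hat r_\varepsilon(y,\eta)|<\infty$. The unperturbed walker $(X_t)$ on $\mathbb Z^d$ jumps from $x$ to $x+y$ at rate $r(y,\tau_x\eta)$ when the (autonomous) environment is in state $\eta$; the perturbed walker $(X^{(\varepsilon)}_t)$ is defined in the same way with $r_\varepsilon$ in place of $r$. (4) The environments seen from the walkers, $(\tau_{X_t}\sigma_t)_{t\ge0}$ and $(\tau_{X^{(\varepsilon)}_t}\sigma_t)_{t\ge0}$, are Feller processes on $\Omega$ with generators on $C(\Omega)$ given by $\mathcal L_{\rm env}+\mathcal L_{\rm jump}$ and $\mathcal L_{\rm env}+\mathcal L_{\rm jump}+\hat{\mathcal L}_\varepsilon$ respectively, both with domain $\mathcal D(\mathcal L_{\rm env})$, where $\mathcal L_{\rm jump}f(\eta)=\sum_yr(y,\eta)[f(\tau_y\eta)-f(\eta)]$ and $\hat{\mathcal L}_\varepsilon f(\eta)=\sum_y\hat r_\varepsilon(y,\eta)[f(\tau_y\eta)-f(\eta)]$. (5) $\mu$ is invariant for $(\tau_{X_t}\sigma_t)_{t\ge0}$. (6) The bounded operator $\hat L_\varepsilon$ on $L^2(\mu)$, $\hat L_\varepsilon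 f(\eta)=\sum_y\hat r_\varepsilon(y,\eta)[f(\tau_y\eta)-f(\eta)]$, has norm $\varepsilon:=\|\hat L_\varepsilon\|<\gamma$. Under these assumptions there is a unique probability measure on $\Omega$ that is absolutely continuous w.r.t. $\mu$ and invariant for $(\tau_{X^{(\varepsilon)}_t}\sigma_t)_{t\ge0}$; it is denoted $\mu_\varepsilon$. *)

theory Defs
  imports "HOL-Probability.Probability"
begin

section \<open>Configurations on the lattice\<close>

type_synonym ('s, 'd) config = "(int, 'd) vec \<Rightarrow> 's"

definition lattice_norm :: "int ^ 'd \<Rightarrow> real" where
  "lattice_norm x = norm (\<chi> i. real_of_int (x $ i))"

definition translate :: "int ^ 'd \<Rightarrow> ('s, 'd) config \<Rightarrow> ('s, 'd) config" where
  "translate x \<eta> = (\<lambda>y. \<eta> (x + y))"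

definition local_function :: "(('s::topological_space, 'd::finite) config \<Rightarrow> real) \<Rightarrow> bool" where
  "local_function f \<longleftrightarrow> f \<in> borel_measurable borel \<and> bounded (range f) \<and>
     (\<exists>A. finite A \<and> (\<forall>\<eta> \<zeta>. (\<forall>x\<in>A. \<eta> x = \<zeta> x) \<longrightarrow> f \<eta> = f \<zeta>))"

definition translation_invariant :: "('s::topological_space, 'd::finite) config measure \<Rightarrow> bool" where
  "translation_invariant \<mu> \<longleftrightarrow> (\<forall>x. distr \<mu> borel (translate x) = \<mu>)"

definition cov :: "'a measure \<Rightarrow> ('a \<Rightarrow> real) \<Rightarrow> ('a \<Rightarrow> real) \<Rightarrow> real" where
  "cov \<mu> f g = (\<integral>\<eta>. f \<eta> * g \<eta> \<partial>\<mu>) - (\<integral>\<eta>. f \<eta> \<partial>\<mu>) * (\<integral>\<eta>. g \<eta> \<partial>\<mu>)"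


section \<open>Feller transition kernels and their generators\<close>

text \<open>
  A Markov process is described by its transition kernels \<open>\<kappa> t \<eta>\<close>, \<open>t \<ge> 0\<close>; the values at negative
  times are irrelevant. The kernels induce the semigroup on \<open>C(\<Omega>)\<close> as well as the one on
  \<open>L\<^sup>2(\<mu>)\<close> for invariant \<open>\<mu>\<close>.
\<close>

definition transition :: "(real \<Rightarrow> 'a \<Rightarrow> 'a measure) \<Rightarrow> real \<Rightarrow> ('a \<Rightarrow> real) \<Rightarrow> 'a \<Rightarrow> real" where
  "transition \<kappa> t f \<eta> = (\<integral>\<zeta>. f \<zeta> \<partial>\<kappa> t \<eta>)"

definition feller_kernel :: "(real \<Rightarrow> 'a \<Rightarrow> 'a::topological_space measure) \<Rightarrow> bool" where
  "feller_kernel \<kappa> \<longleftrightarrow>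
     (\<forall>t\<ge>0. \<kappa> t \<in> borel \<rightarrow>\<^sub>M prob_algebra borel) \<and>
     (\<forall>\<eta>. \<kappa> 0 \<eta> = return borel \<eta>) \<and>
     (\<forall>s\<ge>0. \<forall>t\<ge>0. \<forall>\<eta>. \<kappa> (s + t) \<eta> = \<kappa> s \<eta> \<bind> \<kappa> t) \<and>
     (\<forall>f. continuous_on UNIV f \<longrightarrow>
        (\<forall>t\<ge>0. continuous_on UNIV (transition \<kappa> t f)) \<and>
        uniform_limit UNIV (\<lambda>t. transition \<kappa> t f) f (at_right 0))"

definition invariant :: "'a measure \<Rightarrow> (real \<Rightarrow> 'a \<Rightarrow> 'a measure) \<Rightarrow> bool" where
  "invariant \<mu> \<kappa> \<longleftrightarrow> (\<forall>t\<ge>0. \<mu> \<bind> \<kappa> t = \<mu>)"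

text \<open>
  Generators are represented by their graphs. The state space is compact in the intended use, so
  that uniform convergence is convergence in the sup norm of \<open>C(\<Omega>)\<close>.
\<close>

definition generator_C :: "(real \<Rightarrow> 'a \<Rightarrow> 'a::topological_space measure) \<Rightarrow>
    (('a \<Rightarrow> real) \<times> ('a \<Rightarrow> real)) set" where
  "generator_C \<kappa> = {(f, g). continuous_on UNIV f \<and> continuous_on UNIV g \<and>
     uniform_limit UNIV (\<lambda>t \<eta>. (transition \<kappa> t f \<eta> - f \<eta>) / t) g (at_right 0)}"

text \<open>Elements of \<open>L\<^sup>2(\<mu>)\<close> are represented by functions rather than by classes modulo \<open>\<mu>\<close>-null sets.\<close>

definition L2 :: "'a measure \<Rightarrow> ('a \<Rightarrow> real) set" where
  "L2 \<mu> = {f \<in> borel_measurable \<mu>. integrable \<mu> (\<lambda>\<eta>. (f \<eta>)\<^sup>2)}"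

definition L2_norm :: "'a measure \<Rightarrow> ('a \<Rightarrow> real) \<Rightarrow> real" where
  "L2_norm \<mu> f = sqrt (\<integral>\<eta>. (f \<eta>)\<^sup>2 \<partial>\<mu>)"

definition generator_L2 :: "'a measure \<Rightarrow> (real \<Rightarrow> 'a \<Rightarrow> 'a measure) \<Rightarrow>
    (('a \<Rightarrow> real) \<times> ('a \<Rightarrow> real)) set" where
  "generator_L2 \<mu> \<kappa> = {(f, g). f \<in> L2 \<mu> \<and> g \<in> L2 \<mu> \<and>
     ((\<lambda>t. L2_norm \<mu> (\<lambda>\<eta>. (transition \<kappa> t f \<eta> - f \<eta>) / t - g \<eta>)) \<longlongrightarrow> 0) (at_right 0)}"

definition poincare_inequality :: "'a measure \<Rightarrow> (real \<Rightarrow> 'a \<Rightarrow> 'a measure) \<Rightarrow> real \<Rightarrow> bool" where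
  "poincare_inequality \<mu> \<kappa> \<gamma> \<longleftrightarrow>
     (\<forall>(f, Lf) \<in> generator_L2 \<mu> \<kappa>. (\<integral>\<eta>. f \<eta> \<partial>\<mu>) = 0 \<longrightarrow>
        \<gamma> * (L2_norm \<mu> f)\<^sup>2 \<le> - (\<integral>\<eta>. f \<eta> * Lf \<eta> \<partial>\<mu>))"

definition bounded_L2_operator :: "'a measure \<Rightarrow> (('a \<Rightarrow> real) \<Rightarrow> 'a \<Rightarrow> real) \<Rightarrow> bool" where
  "bounded_L2_operator \<mu> A \<longleftrightarrow>
     (\<exists>K. \<forall>f\<in>L2 \<mu>. A f \<in> L2 \<mu> \<and> L2_norm \<mu> (A f) \<le> K * L2_norm \<mu> f)"

text \<open>As in \<open>onorm\<close>, the quotient is \<open>0\<close> when the denominator vanishes.\<close>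

definition L2_opnorm :: "'a measure \<Rightarrow> (('a \<Rightarrow> real) \<Rightarrow> 'a \<Rightarrow> real) \<Rightarrow> real" where
  "L2_opnorm \<mu> A = (SUP f\<in>L2 \<mu>. L2_norm \<mu> (A f) / L2_norm \<mu> f)"


section \<open>Processes\<close>

definition events :: "'w measure \<Rightarrow> (real \<Rightarrow> 'w \<Rightarrow> 'a::topological_space) \<Rightarrow> real set \<Rightarrow> 'w set set" where
  "events M Y I = {Y u -` B \<inter> space M | u B. u \<in> I \<and> B \<in> sets borel}"

definition cadlag :: "(real \<Rightarrow> 'a::topological_space) \<Rightarrow> bool" where
  "cadlag p \<longleftrightarrow> (\<forall>t\<ge>0. (p \<longlongrightarrow> p t) (at_right t)) \<and> (\<forall>t>0. \<exists>l. (p \<longlongrightarrow> l) (at_left t))"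

definition markov_process :: "'w measure \<Rightarrow> (real \<Rightarrow> 'w \<Rightarrow> 'a::topological_space) \<Rightarrow>
    (real \<Rightarrow> 'a \<Rightarrow> 'a measure) \<Rightarrow> bool" where
  "markov_process M Y \<kappa> \<longleftrightarrow> prob_space M \<and> (\<forall>t\<ge>0. Y t \<in> M \<rightarrow>\<^sub>M borel) \<and>
     (\<forall>s\<ge>0. \<forall>t\<ge>0. \<forall>A \<in> sigma_sets (space M) (events M Y {0..s}). \<forall>B \<in> sets borel.
        measure M (A \<inter> {\<omega> \<in> space M. Y (s + t) \<omega> \<in> B}) =
        (LINT \<omega>:A|M. measure (\<kappa> t (Y s \<omega>)) B))"

text \<open>The law \<open>P \<eta>\<close> describes the process started from the state \<open>\<eta>\<close>.\<close>

definition feller_process :: "('a \<Rightarrow> 'w measure) \<Rightarrow> (real \<Rightarrow> 'w \<Rightarrow> 'a::topological_space) \<Rightarrow>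
    (real \<Rightarrow> 'a \<Rightarrow> 'a measure) \<Rightarrow> bool" where
  "feller_process P Y \<kappa> \<longleftrightarrow> feller_kernel \<kappa> \<and>
     (\<forall>\<eta>. markov_process (P \<eta>) Y \<kappa> \<and> (AE \<omega> in P \<eta>. Y 0 \<omega> = \<eta>))"

definition jump_operator :: "(int ^ 'd \<Rightarrow> ('s, 'd::finite) config \<Rightarrow> real) \<Rightarrow>
    (('s, 'd) config \<Rightarrow> real) \<Rightarrow> ('s, 'd) config \<Rightarrow> real" where
  "jump_operator \<rho> f \<eta> = (\<Sum>\<^sub>\<infinity>y. \<rho> y \<eta> * (f (translate y \<eta>) - f \<eta>))"

text \<open>
  \<open>X\<close> is a walker started at the origin which, when at \<open>x\<close>, jumps to \<open>x + y\<close> at rate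
  \<open>\<rho> y (translate x \<eta>)\<close> when the environment is in state \<open>\<eta>\<close>. The environment being autonomous, this
  means that, given the entire trajectory of \<open>\<sigma>\<close>, \<open>X\<close> is a time-inhomogeneous Markov jump process
  with rates \<open>\<rho> y (translate x (\<sigma> u))\<close> at time \<open>u\<close>. It is expressed by the associated martingale problem
  with respect to the filtration generated by the past of \<open>X\<close> and by all of \<open>\<sigma>\<close>. The topology of the
  lattice is discrete, so that cadlag paths are piecewise constant.
\<close>

definition walker :: "'w measure \<Rightarrow> (real \<Rightarrow> 'w \<Rightarrow> ('s::topological_space, 'd::finite) config) \<Rightarrow>
    (int ^ 'd \<Rightarrow> ('s, 'd) config \<Rightarrow> real) \<Rightarrow> (real \<Rightarrow> 'w \<Rightarrow> int ^ 'd) \<Rightarrow> bool" where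
  "walker M \<sigma> \<rho> X \<longleftrightarrow>
     (\<forall>t\<ge>0. X t \<in> M \<rightarrow>\<^sub>M borel) \<and>
     (\<forall>\<omega>\<in>space M. cadlag (\<lambda>t. X t \<omega>)) \<and>
     (AE \<omega> in M. X 0 \<omega> = 0) \<and>
     (\<forall>s t h A. 0 \<le> s \<longrightarrow> s \<le> t \<longrightarrow> bounded (range h) \<longrightarrow>
        A \<in> sigma_sets (space M) (events M \<sigma> {0..} \<union> events M X {0..s}) \<longrightarrow>
        (LINT \<omega>:A|M. h (X t \<omega>) - h (X s \<omega>) :: real) =
        (LINT \<omega>:A|M. (LINT u:{s..t}|lborel.
           (\<Sum>\<^sub>\<infinity>y. \<rho> y (translate (X u \<omega>) (\<sigma> u \<omega>)) * (h (X u \<omega> + y) - h (X u \<omega>))))))"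

definition seen_from :: "(real \<Rightarrow> 'w \<Rightarrow> int ^ 'd) \<Rightarrow> (real \<Rightarrow> 'w \<Rightarrow> ('s, 'd) config) \<Rightarrow>
    real \<Rightarrow> 'w \<Rightarrow> ('s, 'd) config" where
  "seen_from X \<sigma> t \<omega> = translate (X t \<omega>) (\<sigma> t \<omega>)"

end

theory Submission
  imports Defs
begin

text \<open>
  Since \<open>\<mu>\<^sub>\<epsilon>\<close> is absolutely continuous, it has a density \<open>h \<in> L\<^sup>1(\<mu>)\<close> with \<open>\<mu>(h) = 1\<close>, and the claim
  reads \<open>\<mu>(h \<cdot> \<tau>\<^sub>x f) \<rightarrow> \<mu>(h) \<mu>(f)\<close> as \<open>|x| \<rightarrow> \<infinity>\<close>, so it suffices that the decorrelation
  property extends from local functions to arbitrary \<open>h \<in> L\<^sup>1(\<mu>)\<close> in its first argument.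

  Put \<open>\<psi>\<^sub>x = \<tau>\<^sub>x f - \<mu>(f)\<close>. These functions are bounded uniformly in \<open>x\<close>, so the functionals
  \<open>h \<mapsto> \<mu>(h \<psi>\<^sub>x)\<close> are equicontinuous on \<open>L\<^sup>1(\<mu>)\<close>, and the \<open>h\<close> along which they tend to \<open>0\<close> form a
  closed subspace (\<open>weakly_null_limit\<close>). By decorrelation and translation invariance of \<open>\<mu>\<close> this
  subspace contains the indicators of all cylinder sets. A Dynkin class argument gives the
  indicators of all Borel sets, and these span a dense subspace of \<open>L\<^sup>1(\<mu>)\<close>
  (\<open>weakly_null_if_generator\<close>).
\<close>

section \<open>Uniformly bounded families that tend weakly to zero\<close>

lemma integrable_mult_bounded:
  fixes k \<phi> :: "'a \<Rightarrow> real"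
  assumes "integrable M k" "\<phi> \<in> borel_measurable M" "\<And>a. \<bar>\<phi> a\<bar> \<le> B"
  shows "integrable M (\<lambda>a. k a * \<phi> a)"
  using integrable_mult_right[OF assms(1), of B]
proof (rule Bochner_Integration.integrable_bound)
  have "\<bar>k a\<bar> * \<bar>\<phi> a\<bar> \<le> \<bar>k a\<bar> * \<bar>B\<bar>" for a
    using assms(3)[of a] by (intro mult_left_mono) auto
  then show "AE a in M. norm (k a * \<phi> a) \<le> norm (B * k a)"
    by (simp add: abs_mult mult.commute)
qed (use assms in measurable)

text \<open>
  The pointwise limit of a dominated sequence is its limit in \<open>L\<^sup>1\<close>, and replacing \<open>h\<close> by \<open>s n\<close> changes
  every one of the integrals by at most \<open>B\<close> times their distance in \<open>L\<^sup>1\<close>, uniformly in the index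
  \<open>x\<close> of the family.
\<close>

lemma weakly_null_limit:
  fixes \<psi> :: "'b \<Rightarrow> 'a \<Rightarrow> real" and h w :: "'a \<Rightarrow> real" and s :: "nat \<Rightarrow> 'a \<Rightarrow> real"
  assumes \<psi>_meas: "\<And>x. \<psi> x \<in> borel_measurable M"
    and \<psi>_bound: "\<And>x a. \<bar>\<psi> x a\<bar> \<le> B"
    and s_meas: "\<And>n. s n \<in> borel_measurable M"
    and s_null: "\<And>n. ((\<lambda>x. \<integral>a. s n a * \<psi> x a \<partial>M) \<longlongrightarrow> 0) F"
    and s_lim: "\<And>a. a \<in> space M \<Longrightarrow> (\<lambda>n. s n a) \<longlonglongrightarrow> h a"
    and s_dom: "\<And>n a. a \<in> space M \<Longrightarrow> \<bar>s n a\<bar> \<le> w a"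
    and w_int: "integrable M w"
  shows "((\<lambda>x. \<integral>a. h a * \<psi> x a \<partial>M) \<longlongrightarrow> 0) F"
proof (rule tendstoI)
  fix e :: real
  assume "e > 0"
  have h_meas [measurable]: "h \<in> borel_measurable M"
    using s_lim s_meas by (rule borel_measurable_LIMSEQ_real)
  note [measurable] = \<psi>_meas s_meas borel_measurable_integrable[OF w_int]
  have s_int: "integrable M (s n)" for n
    using w_int
    by (rule Bochner_Integration.integrable_bound) (auto intro!: AE_I2 order_trans[OF s_dom])
  have h_dom: "\<bar>h a\<bar> \<le> w a" if "a \<in> space M" for a
    by (rule LIMSEQ_le_const2[OF tendsto_rabs[OF s_lim[OF that]]]) (use s_dom that in auto)
  have h_int: "integrable M h"
    using w_int
    by (rule Bochner_Integration.integrable_bound) (auto intro!: AE_I2 order_trans[OF h_dom])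
  have "(\<lambda>n. \<integral>a. \<bar>s n a - h a\<bar> \<partial>M) \<longlonglongrightarrow> (\<integral>a. 0 \<partial>M)"
  proof (rule integral_dominated_convergence[where w = "\<lambda>a. 2 * w a"])
    show "AE a in M. (\<lambda>n. \<bar>s n a - h a\<bar>) \<longlonglongrightarrow> 0"
      using s_lim by (auto intro!: AE_I2 tendsto_rabs_zero LIM_zero)
    show "AE a in M. norm \<bar>s n a - h a\<bar> \<le> 2 * w a" for n
      using s_dom[of _ n] h_dom by (intro AE_I2) (smt (verit) real_norm_def)
  qed (use w_int in auto)
  then have "(\<lambda>n. \<bar>B\<bar> * (\<integral>a. \<bar>s n a - h a\<bar> \<partial>M)) \<longlonglongrightarrow> 0"
    by (intro tendsto_mult_right_zero) simp
  then have "\<forall>\<^sub>F n in sequentially. \<bar>B\<bar> * (\<integral>a. \<bar>s n a - h a\<bar> \<partial>M) < e / 2"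
    by (rule order_tendstoD) (use \<open>e > 0\<close> in simp)
  then obtain n where n: "\<bar>B\<bar> * (\<integral>a. \<bar>s n a - h a\<bar> \<partial>M) < e / 2"
    by (auto simp: eventually_sequentially)
  note mult_int = integrable_mult_bounded[OF _ \<psi>_meas \<psi>_bound]
  have diff: "\<bar>(\<integral>a. h a * \<psi> x a \<partial>M) - (\<integral>a. s n a * \<psi> x a \<partial>M)\<bar> < e / 2" for x
  proof -
    have "\<bar>(\<integral>a. h a * \<psi> x a \<partial>M) - (\<integral>a. s n a * \<psi> x a \<partial>M)\<bar>
        = \<bar>\<integral>a. (h a - s n a) * \<psi> x a \<partial>M\<bar>"
      by (simp add: left_diff_distrib mult_int h_int s_int)
    also have "\<dots> \<le> (\<integral>a. \<bar>(h a - s n a) * \<psi> x a\<bar> \<partial>M)"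
      by (rule integral_abs_bound)
    also have "\<dots> \<le> (\<integral>a. \<bar>B\<bar> * \<bar>s n a - h a\<bar> \<partial>M)"
    proof (rule integral_mono)
      show "integrable M (\<lambda>a. \<bar>(h a - s n a) * \<psi> x a\<bar>)"
        by (intro integrable_abs mult_int Bochner_Integration.integrable_diff h_int s_int)
      show "integrable M (\<lambda>a. \<bar>B\<bar> * \<bar>s n a - h a\<bar>)"
        by (intro integrable_mult_right integrable_abs Bochner_Integration.integrable_diff h_int s_int)
      show "\<bar>(h a - s n a) * \<psi> x a\<bar> \<le> \<bar>B\<bar> * \<bar>s n a - h a\<bar>" for a
        using \<psi>_bound[of x a]
        by (simp add: abs_mult abs_minus_commute mult.commute[of "\<bar>h a - s n a\<bar>"] mult_right_mono)
    qed
    finally show ?thesis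
      using n by simp
  qed
  have "\<forall>\<^sub>F x in F. \<bar>\<integral>a. s n a * \<psi> x a \<partial>M\<bar> < e / 2"
    using tendstoD[OF s_null[of n], of "e / 2"] \<open>e > 0\<close> by simp
  then show "\<forall>\<^sub>F x in F. dist (\<integral>a. h a * \<psi> x a \<partial>M) 0 < e"
  proof eventually_elim
    case (elim x)
    then show ?case
      using diff[of x] unfolding dist_real_def by linarith
  qed
qed

text \<open>
  The measurable sets whose indicators \<open>h\<close> satisfy the conclusion form a Dynkin class: complements
  are covered by \<open>null_space\<close>, which has to be assumed because the whole space need not belong to \<open>G\<close>,
  and disjoint countable unions by \<open>weakly_null_limit\<close>. Simple functions are handled by linearity
  and their dominated limits by \<open>weakly_null_limit\<close> once more.
\<close>

lemma weakly_null_if_generator: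
  fixes \<psi> :: "'b \<Rightarrow> 'a \<Rightarrow> real" and h :: "'a \<Rightarrow> real"
  assumes fin: "finite_measure M"
    and gen: "sets M = sigma_sets (space M) G" "Int_stable G" "G \<subseteq> Pow (space M)"
    and \<psi>_meas: "\<And>x. \<psi> x \<in> borel_measurable M"
    and \<psi>_bound: "\<And>x a. \<bar>\<psi> x a\<bar> \<le> B"
    and null_space: "((\<lambda>x. \<integral>a. \<psi> x a \<partial>M) \<longlongrightarrow> 0) F"
    and null_G: "\<And>A. A \<in> G \<Longrightarrow> ((\<lambda>x. \<integral>a. indicator A a * \<psi> x a \<partial>M) \<longlongrightarrow> 0) F"
    and h_int: "integrable M h"
  shows "((\<lambda>x. \<integral>a. h a * \<psi> x a \<partial>M) \<longlongrightarrow> 0) F"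
proof -
  interpret finite_measure M by (fact fin)
  note [measurable] = \<psi>_meas
  note mult_int = integrable_mult_bounded[OF _ \<psi>_meas \<psi>_bound]
  have ind_int: "integrable M (indicator A :: 'a \<Rightarrow> real)" if "A \<in> sets M" for A
    using that by (intro integrable_real_indicator) (auto simp: less_top[symmetric])
  have indicators: "((\<lambda>x. \<integral>a. indicator A a * \<psi> x a \<partial>M) \<longlongrightarrow> 0) F" if "A \<in> sets M" for A
    using gen(2,3) that[unfolded gen(1)]
  proof (induction rule: sigma_sets_induct_disjoint)
    case (basic A)
    then show ?case by (rule null_G)
  next
    case empty
    show ?case by simp
  next
    case (compl A)
    then have A: "A \<in> sets M" by (simp add: gen(1))
    have "(\<integral>a. indicator (space M - A) a * \<psi> x a \<partial>M)
        = (\<integral>a. \<psi> x a \<partial>M) - (\<integral>a. indicator A a * \<psi> x a \<partial>M)" for x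
    proof -
      have "(\<integral>a. indicator (space M - A) a * \<psi> x a \<partial>M)
          = (\<integral>a. 1 * \<psi> x a - indicator A a * \<psi> x a \<partial>M)"
        by (intro Bochner_Integration.integral_cong) (auto simp: indicator_def)
      also have "\<dots> = (\<integral>a. 1 * \<psi> x a \<partial>M) - (\<integral>a. indicator A a * \<psi> x a \<partial>M)"
        by (intro Bochner_Integration.integral_diff mult_int ind_int A integrable_const)
      finally show ?thesis by simp
    qed
    then show ?case
      using tendsto_diff[OF null_space compl(2)] by simp
  next
    case (union A)
    then have A: "A i \<in> sets M" for i by (auto simp: gen(1))
    show ?case
    proof (rule weakly_null_limit[where w = "\<lambda>_. 1"])
      fix n
      have "(\<integral>a. indicator (\<Union>i<n. A i) a * \<psi> x a \<partial>M)
          = (\<Sum>i<n. \<integral>a. indicator (A i) a * \<psi> x a \<partial>M)" for x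
      proof -
        have "(\<integral>a. indicator (\<Union>i<n. A i) a * \<psi> x a \<partial>M)
            = (\<integral>a. (\<Sum>i<n. indicator (A i) a * \<psi> x a) \<partial>M)"
          using union(1)
          by (subst indicator_UN_disjoint)
             (auto simp: sum_distrib_right disjoint_family_on_def)
        also have "\<dots> = (\<Sum>i<n. \<integral>a. indicator (A i) a * \<psi> x a \<partial>M)"
          by (intro Bochner_Integration.integral_sum mult_int ind_int A)
        finally show ?thesis .
      qed
      then show "((\<lambda>x. \<integral>a. indicator (\<Union>i<n. A i) a * \<psi> x a \<partial>M) \<longlongrightarrow> 0) F"
        using tendsto_sum[where I = "{..<n}", OF union(3)] by simp
      show "(indicator (\<Union>i<n. A i) :: 'a \<Rightarrow> real) \<in> borel_measurable M"
        using A by measurable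
    next
      show "(\<lambda>n. indicator (\<Union>i<n. A i) a :: real) \<longlonglongrightarrow> indicator (\<Union>i. A i) a" for a
        by (rule LIMSEQ_indicator_UN)
    qed (auto intro: \<psi>_meas \<psi>_bound simp: indicator_def)
  qed
  show ?thesis
    using h_int
  proof (induction rule: integrable_induct)
    case (base A c)
    have "(\<integral>a. (indicator A a *\<^sub>R c) * \<psi> x a \<partial>M) = c * (\<integral>a. indicator A a * \<psi> x a \<partial>M)" for x
      by (simp add: mult.assoc mult.left_commute[of _ c])
    then show ?case
      using tendsto_mult_right_zero[OF indicators[OF base(1)], of c] by simp
  next
    case (add k l)
    then show ?case
      using tendsto_add[OF add(3,4)] by (simp add: distrib_right mult_int)
  next
    case (lim k s)
    show ?case
    proof (rule weakly_null_limit[where w = "\<lambda>a. 2 * norm (k a)" and s = s])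
      show "integrable M (\<lambda>a. 2 * norm (k a))"
        using lim by (intro integrable_mult_right integrable_norm)
    qed (use lim in \<open>auto intro: \<psi>_meas \<psi>_bound\<close>)
  qed
qed

section \<open>Decorrelation against integrable functions\<close>

lemma translate_measurable:
  "translate x \<in> borel_measurable (borel :: ('s::topological_space, 'd::finite) config measure)"
  by (intro borel_measurable_continuous_onI)
     (auto simp: translate_def intro!: continuous_on_coordinatewise_then_product)

lemma local_function_indicator_cylinder:
  fixes E :: "int ^ 'd::finite \<Rightarrow> 's::topological_space set"
  assumes "finite J" "{\<eta>. \<forall>y\<in>J. \<eta> y \<in> E y} \<in> sets borel"
  shows "local_function (indicator {\<eta>. \<forall>y\<in>J. \<eta> y \<in> E y})"
  unfolding local_function_def
proof (intro conjI exI[of _ J])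
  show "bounded (range (indicator {\<eta>. \<forall>y\<in>J. \<eta> y \<in> E y} :: ('s, 'd) config \<Rightarrow> real))"
    by (intro boundedI[of _ 1]) (auto simp: indicator_def)
qed (use assms in \<open>auto simp: indicator_def\<close>)

text \<open>
  The \<open>\<sigma>\<close>-algebra of the configuration space is generated by the cylinder sets, whose indicators are
  local. By translation invariance the covariance with \<open>\<tau>\<^sub>x f\<close> is the integral against the centred
  functions \<open>\<psi>\<^sub>x = \<tau>\<^sub>x f - \<mu>(f)\<close>, so decorrelation gives the condition on the generator in
  \<open>weakly_null_if_generator\<close>.
\<close>

lemma decorrelation_integrable:
  fixes \<mu> :: "('s::polish_space, 'd::finite) config measure" and f h :: "('s, 'd) config \<Rightarrow> real"
  assumes prob: "prob_space \<mu>" and sets_mu: "sets \<mu> = sets borel"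
    and inv: "translation_invariant \<mu>"
    and f_local: "local_function f"
    and decorr: "\<And>g. local_function g \<Longrightarrow> ((\<lambda>x. cov \<mu> g (f \<circ> translate x)) \<longlongrightarrow> 0) F"
    and h_int: "integrable \<mu> h"
  shows "((\<lambda>x. \<integral>\<eta>. h \<eta> * f (translate x \<eta>) \<partial>\<mu>) \<longlongrightarrow> (\<integral>\<eta>. h \<eta> \<partial>\<mu>) * (\<integral>\<eta>. f \<eta> \<partial>\<mu>)) F"
proof -
  interpret prob_space \<mu> by (fact prob)
  have space_mu: "space \<mu> = UNIV"
    using sets_eq_imp_space_eq[OF sets_mu] by simp
  define c where "c = (\<integral>\<eta>. f \<eta> \<partial>\<mu>)"
  define \<psi> where "\<psi> x \<eta> = f (translate x \<eta>) - c" for x \<eta>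
  have f_meas: "f \<in> borel_measurable borel"
    using f_local by (simp add: local_function_def)
  obtain B where B: "\<bar>f \<eta>\<bar> \<le> B" for \<eta>
    using f_local by (auto simp: local_function_def bounded_iff)
  have comp_meas: "(\<lambda>\<eta>. f (translate x \<eta>)) \<in> borel_measurable \<mu>" for x
    using measurable_compose[OF translate_measurable f_meas]
    by (simp add: measurable_cong_sets[OF sets_mu refl])
  have comp_bound: "\<bar>f (translate x \<eta>)\<bar> \<le> B" for x \<eta>
    by (rule B)
  have comp_int: "integrable \<mu> (\<lambda>\<eta>. f (translate x \<eta>))" for x
    by (rule integrable_const_bound[of _ B]) (auto intro: comp_meas comp_bound)
  have comp_integral: "(\<integral>\<eta>. f (translate x \<eta>) \<partial>\<mu>) = c" for x
  proof -
    have "(\<integral>\<eta>. f (translate x \<eta>) \<partial>\<mu>) = (\<integral>\<eta>. f \<eta> \<partial>distr \<mu> borel (translate x))"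
      by (rule integral_distr[symmetric])
         (use translate_measurable in \<open>auto simp: measurable_cong_sets[OF sets_mu refl] f_meas\<close>)
    also have "distr \<mu> borel (translate x) = \<mu>"
      using inv by (simp add: translation_invariant_def)
    finally show ?thesis by (simp add: c_def)
  qed
  note mult_int = integrable_mult_bounded[OF _ comp_meas comp_bound]
  have \<psi>_integral: "(\<integral>\<eta>. k \<eta> * \<psi> x \<eta> \<partial>\<mu>) = (\<integral>\<eta>. k \<eta> * f (translate x \<eta>) \<partial>\<mu>) - (\<integral>\<eta>. k \<eta> \<partial>\<mu>) * c"
    if k: "integrable \<mu> k" for k x
    by (simp add: \<psi>_def right_diff_distrib mult_int k)
  have local_null: "((\<lambda>x. \<integral>\<eta>. g \<eta> * \<psi> x \<eta> \<partial>\<mu>) \<longlongrightarrow> 0) F" if g: "local_function g" for g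
  proof -
    have g_meas: "g \<in> borel_measurable \<mu>"
      using g by (simp add: local_function_def measurable_cong_sets[OF sets_mu refl])
    obtain C where "\<bar>g \<eta>\<bar> \<le> C" for \<eta>
      using g by (auto simp: local_function_def bounded_iff)
    then have "integrable \<mu> g"
      by (intro integrable_const_bound[of _ C]) (auto intro: g_meas)
    then show ?thesis
      using decorr[OF g] by (simp add: \<psi>_integral cov_def comp_integral)
  qed
  have sets_PiM_mu: "sets \<mu> = sets (Pi\<^sub>M (UNIV :: (int ^ 'd) set) (\<lambda>_. borel :: 's measure))"
    unfolding sets_PiM_equal_borel by (fact sets_mu)
  have "((\<lambda>x. \<integral>\<eta>. h \<eta> * \<psi> x \<eta> \<partial>\<mu>) \<longlongrightarrow> 0) F"
  proof (rule weakly_null_if_generator)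
    show "finite_measure \<mu>" by (rule finite_measure_axioms)
    show "sets \<mu> = sigma_sets (space \<mu>) (prod_algebra (UNIV :: (int ^ 'd) set) (\<lambda>_. borel :: 's measure))"
      unfolding sets_PiM_mu sets_PiM by (simp add: space_mu PiE_def extensional_def)
    show "Int_stable (prod_algebra (UNIV :: (int ^ 'd) set) (\<lambda>_. borel :: 's measure))"
      by (rule Int_stable_prod_algebra)
    show "prod_algebra (UNIV :: (int ^ 'd) set) (\<lambda>_. borel :: 's measure) \<subseteq> Pow (space \<mu>)"
      by (simp add: space_mu)
    show "\<psi> x \<in> borel_measurable \<mu>" for x
      unfolding \<psi>_def using comp_meas by measurable
    show "\<bar>\<psi> x \<eta>\<bar> \<le> B + \<bar>c\<bar>" for x \<eta>
      using comp_bound[of x \<eta>] unfolding \<psi>_def by linarith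
    show "((\<lambda>x. \<integral>\<eta>. \<psi> x \<eta> \<partial>\<mu>) \<longlongrightarrow> 0) F"
      using \<psi>_integral[of "\<lambda>_. 1"] by (simp add: comp_integral prob_space)
    show "((\<lambda>x. \<integral>\<eta>. indicator A \<eta> * \<psi> x \<eta> \<partial>\<mu>) \<longlongrightarrow> 0) F"
      if A: "A \<in> prod_algebra (UNIV :: (int ^ 'd) set) (\<lambda>_. borel :: 's measure)" for A
    proof -
      from A obtain J and E :: "int ^ 'd \<Rightarrow> 's set"
        where J: "A = prod_emb UNIV (\<lambda>_. borel) J (Pi\<^sub>E J E)" "finite J"
        by (rule prod_algebraE)
      have A_eq: "A = {\<eta>. \<forall>y\<in>J. \<eta> y \<in> E y}"
        unfolding J(1) by (auto simp: prod_emb_def PiE_iff)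
      have "A \<in> sets borel"
        using A unfolding sets_mu[symmetric] sets_PiM_mu sets_PiM by (rule sigma_sets.Basic)
      then show ?thesis
        using J(2) unfolding A_eq by (intro local_null local_function_indicator_cylinder)
    qed
  qed (fact h_int)
  then show ?thesis
    unfolding \<psi>_integral[OF h_int] c_def[symmetric] by (rule LIM_zero_cancel)
qed

theorem theorem2:
  fixes \<mu> \<mu>_eps :: "('s::polish_space, 'd::finite) config measure"
    and P :: "('s, 'd) config \<Rightarrow> 'w measure"
    and \<sigma> :: "real \<Rightarrow> 'w \<Rightarrow> ('s, 'd) config"
    and X X_eps :: "real \<Rightarrow> 'w \<Rightarrow> int ^ 'd"
    and \<kappa>_env \<kappa> \<kappa>_eps :: "real \<Rightarrow> ('s, 'd) config \<Rightarrow> ('s, 'd) config measure"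
    and r r_eps r_hat :: "int ^ 'd \<Rightarrow> ('s, 'd) config \<Rightarrow> real"
    and \<gamma> \<epsilon> :: real
    and f :: "('s, 'd) config \<Rightarrow> real"
  assumes compact_S: "compact (UNIV :: 's set)"
    and mu_prob: "prob_space \<mu>" "sets \<mu> = sets borel"
    and mu_translation: "translation_invariant \<mu>"
    and env_feller: "feller_process P \<sigma> \<kappa>_env"
    and env_cadlag: "\<And>\<eta> \<omega>. \<omega> \<in> space (P \<eta>) \<Longrightarrow> cadlag (\<lambda>t. \<sigma> t \<omega>)"
    and env_stationary: "invariant \<mu> \<kappa>_env"
    and env_commutes: "\<And>g t x. g \<in> L2 \<mu> \<Longrightarrow> t \<ge> 0 \<Longrightarrow>
      AE \<eta> in \<mu>. transition \<kappa>_env t (g \<circ> translate x) \<eta> = (transition \<kappa>_env t g \<circ> translate x) \<eta>"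
    and gamma_pos: "\<gamma> > 0"
    and poincare: "poincare_inequality \<mu> \<kappa>_env \<gamma>"
    and rates_cont: "\<And>y. continuous_on UNIV (r y)" "\<And>y. continuous_on UNIV (r_eps y)"
      "\<And>y. continuous_on UNIV (r_hat y)"
    and rates_0: "\<And>\<eta>. r 0 \<eta> = 0" "\<And>\<eta>. r_eps 0 \<eta> = 0" "\<And>\<eta>. r_hat 0 \<eta> = 0"
    and rates_nonneg: "\<And>y \<eta>. r y \<eta> \<ge> 0" "\<And>y \<eta>. r_eps y \<eta> \<ge> 0"
    and rates_sum: "\<And>y \<eta>. r_eps y \<eta> = r y \<eta> + r_hat y \<eta>"
    and rates_summable: "\<exists>n\<ge>1::nat.
      (\<lambda>y. lattice_norm y ^ n * (SUP \<eta>. r y \<eta>)) summable_on UNIV \<and>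
      (\<lambda>y. lattice_norm y ^ n * (SUP \<eta>. \<bar>r_hat y \<eta>\<bar>)) summable_on UNIV"
    and walker: "\<And>\<eta>. walker (P \<eta>) \<sigma> r X"
    and walker_eps: "\<And>\<eta>. walker (P \<eta>) \<sigma> r_eps X_eps"
    and seen_feller: "feller_process P (seen_from X \<sigma>) \<kappa>"
    and seen_generator: "generator_C \<kappa> =
      {(g, \<lambda>\<eta>. Lg \<eta> + jump_operator r g \<eta>) | g Lg. (g, Lg) \<in> generator_C \<kappa>_env}"
    and seen_eps_feller: "feller_process P (seen_from X_eps \<sigma>) \<kappa>_eps"
    and seen_eps_generator: "generator_C \<kappa>_eps =
      {(g, \<lambda>\<eta>. Lg \<eta> + jump_operator r g \<eta> + jump_operator r_hat g \<eta>) | g Lg.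
        (g, Lg) \<in> generator_C \<kappa>_env}"
    and mu_invariant: "invariant \<mu> \<kappa>"
    and hat_bounded: "bounded_L2_operator \<mu> (jump_operator r_hat)"
    and eps_def: "\<epsilon> = L2_opnorm \<mu> (jump_operator r_hat)"
    and eps_less: "\<epsilon> < \<gamma>"
    \<comment> \<open>the invariant measure of the perturbed environment seen from the walker\<close>
    and mu_eps_prob: "prob_space \<mu>_eps" "sets \<mu>_eps = sets borel"
    and mu_eps_ac: "absolutely_continuous \<mu> \<mu>_eps"
    and mu_eps_invariant: "invariant \<mu>_eps \<kappa>_eps"
    and decorrelation: "\<And>g h. local_function g \<Longrightarrow> local_function h \<Longrightarrow>
      ((\<lambda>x. cov \<mu> g (h \<circ> translate x)) \<longlongrightarrow> 0) (filtercomap lattice_norm at_top)"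
    and f_local: "local_function f"
  shows "((\<lambda>x. \<integral>\<eta>. (f \<circ> translate x) \<eta> \<partial>\<mu>_eps) \<longlongrightarrow> (\<integral>\<eta>. f \<eta> \<partial>\<mu>))
           (filtercomap lattice_norm at_top)"
proof -
  interpret mu: prob_space \<mu> by (fact mu_prob(1))
  interpret mu_eps: prob_space \<mu>_eps by (fact mu_eps_prob(1))
  have sets_eq: "sets \<mu>_eps = sets \<mu>"
    by (simp add: mu_prob(2) mu_eps_prob(2))
  obtain D where D: "D \<in> borel_measurable \<mu>" "AE \<eta> in \<mu>. RN_deriv \<mu> \<mu>_eps \<eta> = ennreal (D \<eta>)"
      "\<And>\<eta>. 0 \<le> D \<eta>"
    using mu.real_RN_deriv[OF mu_eps.finite_measure_axioms mu_eps_ac sets_eq] by metis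
  have "density \<mu> (\<lambda>\<eta>. ennreal (D \<eta>)) = density \<mu> (RN_deriv \<mu> \<mu>_eps)"
    by (rule density_cong) (use D in auto)
  then have density: "\<mu>_eps = density \<mu> (\<lambda>\<eta>. ennreal (D \<eta>))"
    using mu.density_RN_deriv[OF mu_eps_ac sets_eq] by simp
  have change: "(\<integral>\<eta>. k \<eta> \<partial>\<mu>_eps) = (\<integral>\<eta>. D \<eta> * k \<eta> \<partial>\<mu>)" if "k \<in> borel_measurable borel" for k
    unfolding density using that D
    by (subst integral_density) (auto simp: measurable_cong_sets[OF mu_prob(2) refl])
  have D_integral: "(\<integral>\<eta>. D \<eta> \<partial>\<mu>) = 1"
    using change[of "\<lambda>_. 1"] by (simp add: mu_eps.prob_space)
  \<comment> \<open>a function that is not integrable has integral \<open>0\<close>\<close>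
  then have D_int: "integrable \<mu> D"
    using not_integrable_integral_eq[of \<mu> D] by auto
  have "f \<in> borel_measurable borel"
    using f_local by (simp add: local_function_def)
  then have "(\<lambda>\<eta>. f (translate x \<eta>)) \<in> borel_measurable borel" for x
    using measurable_compose[OF translate_measurable] by blast
  then show ?thesis
    using decorrelation_integrable[OF mu_prob mu_translation f_local decorrelation[OF _ f_local] D_int]
    by (simp add: change D_integral)
qed

end
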